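(* For any integers $k \geq 2$ and $\beta,n,\rho \geq 0$, $$C^k_{n,(0,\beta),\rho} = \frac{k\rho+\beta-\rho}{kn+\beta-\rho} \binom{kn+\beta-\rho}{n-\rho},$$ where in the single degenerate case $n=\rho=\beta=0$ the right-hand side is interpreted as $1$.
   Context: For an integer $k\ge 2$ and integers $\beta, n\ge 0$, consider the integer lattice paths from $(0,0)$ to $(kn+\beta,\beta)$ using steps $U=(1,1)$ and $D=(1,1-k)$ that stay weakly above the line $y=0$ (such paths have exactly $n$ steps $D$; the empty path is included when $n=\beta=0$). A return to ground is a $D$ step whose right endpoint lies on $y=0$ (the initial point $(0,0)$ is not a return). $C^k_{n,(0,\beta),\rho}$ is the number of such paths with exactly $\rho$ returns to ground. Convention: $\binom{a}{b}=0$ if $a<0$ or $b<0$. *)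

theory Defs
  imports Complex_Main "HOL-Library.Product_Plus"
begin

datatype step = U | D

fun step_vec :: "nat \<Rightarrow> step \<Rightarrow> int \<times> int" where
  "step_vec k U = (1, 1)"
| "step_vec k D = (1, 1 - int k)"

text \<open>A path starting at the origin is given by its list of steps; it visits the lattice points
  \<open>vertex k p 0, \<dots>, vertex k p (length p)\<close>.\<close>

definition vertex :: "nat \<Rightarrow> step list \<Rightarrow> nat \<Rightarrow> int \<times> int" where
  "vertex k p i = (\<Sum>s\<leftarrow>take i p. step_vec k s)"

text \<open>The steps are straight segments, so a path stays weakly above the line \<open>y = 0\<close> iff all of
  its vertices do. The endpoint determines the number of steps, so this set is finite.\<close>

definition paths :: "nat \<Rightarrow> nat \<Rightarrow> nat \<Rightarrow> step list set" where
  "paths k n \<beta> = {p. vertex k p (length p) = (int (k * n + \<beta>), int \<beta>) \<and>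
     (\<forall>i\<le>length p. 0 \<le> snd (vertex k p i))}"

definition returns :: "nat \<Rightarrow> step list \<Rightarrow> nat" where
  "returns k p = card {i. i < length p \<and> p ! i = D \<and> snd (vertex k p (Suc i)) = 0}"

definition num_paths :: "nat \<Rightarrow> nat \<Rightarrow> nat \<Rightarrow> nat \<Rightarrow> nat" where
  "num_paths k n \<beta> \<rho> = card {p \<in> paths k n \<beta>. returns k p = \<rho>}"

text \<open>Binomial coefficient with integer arguments, zero if either argument is negative. In
  particular it is not the generalised binomial coefficient \<open>gchoose\<close> for negative upper argument.\<close>

definition int_binomial :: "int \<Rightarrow> int \<Rightarrow> nat" where
  "int_binomial a b = (if a < 0 \<or> b < 0 then 0 else nat a choose nat b)"

end

theory Submission
  imports Defs
begin

text \<open>Removing the last step of a path gives a recursion in which \<open>\<beta>\<close> and \<open>n\<close> vary, and \<open>\<rho>\<close>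
  drops exactly when the last step is a down step ending at height \<open>0\<close>. With \<open>m = n - \<rho>\<close> and
  \<open>a = (k - 1) \<rho> + \<beta>\<close> the closed form is the Raney number
  \<open>a / (k m + a) * binom (k m + a) m\<close>. A path ending with a return keeps \<open>(m, a)\<close> under
  that removal, and for \<open>\<beta> > 0\<close> the recursion is the one for Raney numbers.\<close>

lemma vertex_append:
  "i \<le> length p \<Longrightarrow> vertex k (p @ q) i = vertex k p i"
  by (simp add: vertex_def)

lemma vertex_snoc:
  "vertex k (p @ [s]) (Suc (length p)) = vertex k p (length p) + step_vec k s"
  by (simp add: vertex_def)

text \<open>No step rises by more than it advances. This excludes a final down step when
  \<open>n = 0\<close>: removing it would leave the endpoint
  \<open>(\<beta> - 1, \<beta> + k - 1)\<close>, above the diagonal.\<close>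

lemma snd_vertex_le_fst: "snd (vertex k p i) \<le> fst (vertex k p i)"
proof -
  have "snd (step_vec k s) \<le> fst (step_vec k s)" for s
    by (cases s) auto
  then have "snd (\<Sum>s\<leftarrow>q. step_vec k s) \<le> fst (\<Sum>s\<leftarrow>q. step_vec k s)" for q
    by (induction q) (auto intro: add_mono)
  then show ?thesis by (simp add: vertex_def)
qed

text \<open>The new endpoint has height \<open>int \<beta>\<close>, which is nonnegative, so only
  the vertices of \<open>p\<close> remain to be checked.\<close>

lemma snoc_in_paths_iff:
  "p @ [s] \<in> paths k n \<beta> \<longleftrightarrow>
     vertex k p (length p) + step_vec k s = (int (k * n + \<beta>), int \<beta>) \<and>
     (\<forall>i\<le>length p. 0 \<le> snd (vertex k p i))"
proof -
  have "snd (vertex k p (length p)) + snd (step_vec k s) = int \<beta>"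
    if "vertex k p (length p) + step_vec k s = (int (k * n + \<beta>), int \<beta>)"
    using that by (metis snd_add snd_conv)
  then show ?thesis
    unfolding paths_def by (auto simp: le_Suc_eq vertex_append vertex_snoc)
qed

lemma Nil_in_paths_iff:
  assumes "k > 0"
  shows "[] \<in> paths k n \<beta> \<longleftrightarrow> n = 0 \<and> \<beta> = 0"
  using assms by (auto simp: paths_def vertex_def zero_prod_def)

lemma snoc_U_in_paths_iff:
  "p @ [U] \<in> paths k n \<beta> \<longleftrightarrow> (\<exists>h. \<beta> = Suc h \<and> p \<in> paths k n h)"
proof (cases \<beta>)
  case 0
  then show ?thesis
    by (cases "vertex k p (length p)") (force simp: snoc_in_paths_iff)
next
  case (Suc h)
  then show ?thesis
    unfolding snoc_in_paths_iff by (cases "vertex k p (length p)") (auto simp: paths_def)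
qed

text \<open>Since \<open>k * Suc m + \<beta> - 1 = k * m + (\<beta> + k - 1)\<close>, undoing
  \<open>D\<close> gives an endpoint of the same form, with one down step fewer.\<close>

lemma snoc_D_in_paths_iff:
  assumes "k > 0"
  shows "p @ [D] \<in> paths k n \<beta> \<longleftrightarrow> (\<exists>m. n = Suc m \<and> p \<in> paths k m (\<beta> + k - 1))"
proof (cases n)
  case 0
  then show ?thesis
    using snd_vertex_le_fst[of k p "length p"] assms
    by (cases "vertex k p (length p)") (auto simp: snoc_in_paths_iff)
next
  case (Suc m)
  then show ?thesis
    using assms unfolding snoc_in_paths_iff
    by (cases "vertex k p (length p)")
      (auto simp: paths_def of_nat_diff algebra_simps)
qed

lemma returns_Nil: "returns k [] = 0"
  by (simp add: returns_def)

lemma returns_snoc: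
  "returns k (p @ [s]) = returns k p +
     (if s = D \<and> snd (vertex k (p @ [s]) (Suc (length p))) = 0 then 1 else 0)"
proof -
  let ?A = "{i. i < length p \<and> p ! i = D \<and> snd (vertex k p (Suc i)) = 0}"
  let ?B = "{i. i < length (p @ [s]) \<and> (p @ [s]) ! i = D \<and> snd (vertex k (p @ [s]) (Suc i)) = 0}"
  have "?B = (if s = D \<and> snd (vertex k (p @ [s]) (Suc (length p))) = 0
              then insert (length p) ?A else ?A)"
    by (auto simp: nth_append vertex_append less_Suc_eq)
  then show ?thesis
    unfolding returns_def by (cases s) auto
qed

lemma returns_snoc_path:
  assumes "p @ [s] \<in> paths k n \<beta>"
  shows "returns k (p @ [s]) = returns k p + (if s = D \<and> \<beta> = 0 then 1 else 0)"
  using assms by (simp add: returns_snoc paths_def)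

definition counted_paths :: "nat \<Rightarrow> nat \<Rightarrow> nat \<Rightarrow> nat \<Rightarrow> step list set" where
  "counted_paths k n \<beta> \<rho> = {p \<in> paths k n \<beta>. returns k p = \<rho>}"

lemma num_paths_eq_card: "num_paths k n \<beta> \<rho> = card (counted_paths k n \<beta> \<rho>)"
  by (simp add: num_paths_def counted_paths_def)

lemma Nil_in_counted_paths_iff:
  "k > 0 \<Longrightarrow> [] \<in> counted_paths k n \<beta> \<rho> \<longleftrightarrow> n = 0 \<and> \<beta> = 0 \<and> \<rho> = 0"
  by (auto simp: counted_paths_def Nil_in_paths_iff returns_Nil)

lemma snoc_U_in_counted_paths_iff:
  "p @ [U] \<in> counted_paths k n \<beta> \<rho> \<longleftrightarrow> (\<exists>h. \<beta> = Suc h \<and> p \<in> counted_paths k n h \<rho>)"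
  using returns_snoc_path[of p U k n \<beta>]
  by (auto simp: counted_paths_def snoc_U_in_paths_iff)

lemma snoc_D_in_counted_paths_iff:
  assumes "k > 0"
  shows "p @ [D] \<in> counted_paths k n \<beta> \<rho> \<longleftrightarrow>
    (\<exists>m r. n = Suc m \<and> \<rho> = r + (if \<beta> = 0 then 1 else 0) \<and> p \<in> counted_paths k m (\<beta> + k - 1) r)"
  using returns_snoc_path[of p D k n \<beta>] assms
  by (auto simp: counted_paths_def snoc_D_in_paths_iff)

lemma set_decompose_last_step:
  assumes "([] \<in> A) = e" "\<And>p. p @ [U] \<in> A \<longleftrightarrow> p \<in> B" "\<And>p. p @ [D] \<in> A \<longleftrightarrow> p \<in> C"
  shows "A = (if e then {[]} else {}) \<union> (\<lambda>p. p @ [U]) ` B \<union> (\<lambda>p. p @ [D]) ` C"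
proof (rule set_eqI)
  fix p
  show "p \<in> A \<longleftrightarrow> p \<in> (if e then {[]} else {}) \<union> (\<lambda>p. p @ [U]) ` B \<union> (\<lambda>p. p @ [D]) ` C"
  proof (cases p rule: rev_cases)
    case Nil
    then show ?thesis using assms(1) by auto
  next
    case (snoc q s)
    then show ?thesis using assms(2,3) by (cases s) auto
  qed
qed

text \<open>The pieces are disjoint because their last steps differ. Finiteness is carried along
  because \<open>card\<close> is 0 on infinite sets.\<close>

lemma card_by_last_step:
  assumes "([] \<in> A) = e" "\<And>p. p @ [U] \<in> A \<longleftrightarrow> p \<in> B" "\<And>p. p @ [D] \<in> A \<longleftrightarrow> p \<in> C"
    and "finite B" "finite C"
  shows "finite A \<and> card A = (if e then 1 else 0) + card B + card C"
proof -
  have "inj_on (\<lambda>p. p @ [s]) X" for s and X :: "step list set"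
    by (simp add: inj_on_def)
  moreover have "(\<lambda>p. p @ [U]) ` B \<inter> (\<lambda>p. p @ [D]) ` C = {}"
    by auto
  moreover have "[] \<notin> (\<lambda>p. p @ [U]) ` B \<union> (\<lambda>p. p @ [D]) ` C"
    by auto
  moreover note assms(4,5)
  ultimately have "finite ((\<lambda>p. p @ [U]) ` B \<union> (\<lambda>p. p @ [D]) ` C)"
    "card ((\<lambda>p. p @ [U]) ` B \<union> (\<lambda>p. p @ [D]) ` C) = card B + card C"
    "[] \<notin> (\<lambda>p. p @ [U]) ` B \<union> (\<lambda>p. p @ [D]) ` C"
    by (simp_all add: card_Un_disjoint card_image)
  then show ?thesis
    by (subst (1 2) set_decompose_last_step[OF assms(1-3)]) (simp split del: if_split, simp)
qed

text \<open>The coefficient of \<open>x^m\<close> in \<open>B^a\<close>, where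
  \<open>B = 1 + x * B^k\<close>. The case \<open>m = 0\<close> stands apart because the quotient at
  \<open>m = a = 0\<close> would be \<open>0 / 0 = 0\<close>.\<close>

definition raney :: "nat \<Rightarrow> nat \<Rightarrow> nat \<Rightarrow> real" where
  "raney k m a = (if m = 0 then 1 else real a / real (k * m + a) * real ((k * m + a) choose m))"

text \<open>This compares coefficients in \<open>B^(a+1) = B^a + x * B^(a+k)\<close>. The proof is
  direct: both terms on the right have upper index \<open>M\<close>, and Pascal's rule and
  absorption relate their binomials to the one on the left.\<close>

lemma raney_Suc_rec:
  assumes "k \<ge> 2"
  shows "raney k (Suc m) (Suc a) = raney k (Suc m) a + raney k m (a + k)"
proof -
  define M where "M = k * m + k + a"
  have M0: "M > 0" using assms by (simp add: M_def)
  have up: "real (Suc m) * real (Suc M choose Suc m) = real (Suc M) * real (M choose m)"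
    using Suc_times_binomial_eq[of M m] by (metis mult.commute of_nat_mult)
  have pascal: "real (Suc M choose Suc m) = real (M choose m) + real (M choose Suc m)"
    by simp
  have "real (Suc a) / real (Suc M) * real (Suc M choose Suc m)
      = real a / real M * real (M choose Suc m) + real (a + k) / real M * real (M choose m)"
  proof -
    define X Y where "X = real (M choose m)" and "Y = real (Suc M choose Suc m)"
    \<comment> \<open>By Pascal, \<open>Y - X\<close> is \<open>M choose Suc m\<close>. Absorption
      turns \<open>k * X * Suc M\<close> into \<open>k * Suc m * Y\<close>, and
      \<open>k * Suc m + a = M\<close> closes the identity.\<close>
    have "real (Suc a) * real M * Y = (real a * (Y - X) + real (a + k) * X) * real (Suc M)"
      using up unfolding X_def[symmetric] Y_def[symmetric] by (simp add: M_def) algebra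
    then show ?thesis
      using M0 pascal unfolding X_def[symmetric] Y_def[symmetric]
      by (simp add: field_simps)
  qed
  moreover have "raney k m (a + k) = real (a + k) / real M * real (M choose m)"
    using assms by (cases "m = 0") (simp_all add: raney_def M_def add_ac field_simps)
  ultimately show ?thesis
    by (simp add: raney_def M_def add_ac)
qed

text \<open>Induction on the number of steps \<open>k * n + \<beta>\<close>, which drops by one when
  either kind of last step is removed.\<close>

lemma counted_paths_card:
  assumes "k \<ge> 2"
  shows "finite (counted_paths k n \<beta> \<rho>) \<and> real (card (counted_paths k n \<beta> \<rho>)) =
    (if n < \<rho> then 0 else raney k (n - \<rho>) ((k - 1) * \<rho> + \<beta>))"
proof (induction "k * n + \<beta>" arbitrary: n \<beta> \<rho> rule: less_induct)
  case less
  let ?A = "counted_paths k n \<beta> \<rho>"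
  have k0: "k > 0" using assms by simp
  note mem = Nil_in_counted_paths_iff[OF k0] snoc_U_in_counted_paths_iff
    snoc_D_in_counted_paths_iff[OF k0]
  show ?case
  proof (cases \<beta>)
    case \<beta>: 0
    show ?thesis
    proof (cases "n > 0 \<and> \<rho> > 0")
      case True
      then obtain m r where mr: "n = Suc m" "\<rho> = Suc r"
        by (metis gr0_conv_Suc)
      \<comment> \<open>Height 0 is reached only by a down step, which is a return. Both
        \<open>n - \<rho>\<close> and \<open>(k - 1) * \<rho> + \<beta>\<close> keep their values,
        so no recursion for \<open>raney\<close> is involved.\<close>
      let ?C = "counted_paths k m (k - 1) r"
      have IH: "finite ?C \<and> real (card ?C) =
          (if m < r then 0 else raney k (m - r) ((k - 1) * r + (k - 1)))"
        by (rule less) (use k0 mr \<beta> in simp)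
      have "finite ?A \<and> card ?A = (if False then 1 else 0) + card ({} :: step list set) + card ?C"
        by (rule card_by_last_step) (use IH in \<open>auto simp: mem mr \<beta>\<close>)
      then show ?thesis
        using IH by (simp add: mr \<beta> add.commute)
    next
      case False
      \<comment> \<open>At most the empty path is left. For \<open>n > 0\<close> and
        \<open>\<rho> = 0\<close> the formula agrees because its factor \<open>a\<close> is
        0.\<close>
      have "finite ?A \<and> card ?A = (if n = 0 \<and> \<rho> = 0 then 1 else 0) + card ({} :: step list set) + card ({} :: step list set)"
        by (rule card_by_last_step) (use False in \<open>auto simp: mem \<beta>\<close>)
      then show ?thesis
        using False by (auto simp: raney_def \<beta>)
    qed
  next
    case \<beta>: (Suc h)
    let ?B = "counted_paths k n h \<rho>"
    have IHU: "finite ?B \<and> real (card ?B) =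
        (if n < \<rho> then 0 else raney k (n - \<rho>) ((k - 1) * \<rho> + h))"
      by (rule less) (use \<beta> in simp)
    show ?thesis
    proof (cases n)
      case n: 0
      have "finite ?A \<and> card ?A = (if False then 1 else 0) + card ?B + card ({} :: step list set)"
        by (rule card_by_last_step) (use IHU in \<open>auto simp: mem \<beta> n\<close>)
      then show ?thesis
        using IHU by (auto simp: raney_def n)
    next
      case n: (Suc m)
      \<comment> \<open>A down step to positive height is no return, so \<open>\<rho>\<close> stays
        fixed.\<close>
      let ?C = "counted_paths k m (h + k) \<rho>"
      have IHD: "finite ?C \<and> real (card ?C) =
          (if m < \<rho> then 0 else raney k (m - \<rho>) ((k - 1) * \<rho> + (h + k)))"
        by (rule less) (use \<beta> n in simp)
      have card: "finite ?A \<and> card ?A = (if False then 1 else 0) + card ?B + card ?C"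
        by (rule card_by_last_step) (use IHU IHD in \<open>auto simp: mem \<beta> n\<close>)
      show ?thesis
      proof (cases "m < \<rho>")
        case True
        \<comment> \<open>Either \<open>n < \<rho>\<close> and all counts vanish, or
          \<open>n = \<rho>\<close> and only up steps contribute, with \<open>raney\<close> equal to
          1 at \<open>m = 0\<close> on both sides.\<close>
        then show ?thesis
          using card IHU IHD by (auto simp: raney_def n)
      next
        case False
        then show ?thesis
          using card IHU IHD raney_Suc_rec[OF assms, of "m - \<rho>" "(k - 1) * \<rho> + h"]
          by (simp add: n \<beta> Suc_diff_le add.assoc)
      qed
    qed
  qed
qed

theorem theorem3p8:
  fixes k n \<beta> \<rho> :: nat
  assumes "k \<ge> 2"
  shows "real (num_paths k n \<beta> \<rho>) =
    (if n = 0 \<and> \<rho> = 0 \<and> \<beta> = 0 then 1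
     else real_of_int (int k * int \<rho> + int \<beta> - int \<rho>) / real_of_int (int k * int n + int \<beta> - int \<rho>)
          * real (int_binomial (int k * int n + int \<beta> - int \<rho>) (int n - int \<rho>)))"
proof (cases "n < \<rho>")
  case True
  then show ?thesis
    using counted_paths_card[OF assms, of n \<beta> \<rho>]
    by (simp add: num_paths_eq_card int_binomial_def)
next
  case False
  define m a where "m = n - \<rho>" and "a = (k - 1) * \<rho> + \<beta>"
  have n: "n = m + \<rho>" using False by (simp add: m_def)
  have a: "int k * int \<rho> + int \<beta> - int \<rho> = int a"
    using assms by (cases k) (simp_all add: a_def algebra_simps)
  have N: "int k * int n + int \<beta> - int \<rho> = int (k * m + a)"
    using a by (simp add: n algebra_simps)
  have d: "int n - int \<rho> = int m" by (simp add: n)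
  \<comment> \<open>For \<open>m = 0\<close> the quotient formula gives 1 as long as
    \<open>a > 0\<close>; thus the exceptional value is needed only for
    \<open>n = \<rho> = \<beta> = 0\<close>.\<close>
  have "a = 0 \<longleftrightarrow> \<rho> = 0 \<and> \<beta> = 0"
    using assms by (auto simp: a_def)
  then have "raney k m a = (if n = 0 \<and> \<rho> = 0 \<and> \<beta> = 0 then 1
      else real a / real (k * m + a) * real ((k * m + a) choose m))"
    using assms by (auto simp: raney_def n)
  moreover have "real (num_paths k n \<beta> \<rho>) = raney k m a"
    using counted_paths_card[OF assms, of n \<beta> \<rho>] False
    by (simp add: num_paths_eq_card m_def a_def)
  moreover have "int_binomial (int (k * m + a)) (int m) = (k * m + a) choose m"
    unfolding int_binomial_def by (simp only: nat_int of_nat_less_0_iff) simp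
  ultimately show ?thesis
    unfolding a N d by simp
qed

end
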